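(* Let $u$ be a coherent utility function with determining set $\mathcal D$, $X=(X^1,\dots,X^d)$ with $X^i\in L^1_w(\mathcal D)$, $W\in L^1_s(\mathcal D)$, and let $H\subseteq\mathbb R^d$ be a closed convex cone. Put $$G=\mathrm{cl}\{\mathsf E_{\mathsf Q}(X,W):\mathsf Q\in\mathcal D\}\subset\mathbb R^{d+1},\qquad \widetilde H=\{x\in\mathbb R^{d+1}:(x^1,\dots,x^d)\in H,\ x^{d+1}=1\},$$ $$\widetilde H^*=\{x\in\mathbb R^{d+1}:\langle h,x\rangle\le0\ \forall h\in\widetilde H\},\qquad e=(0,\dots,0,1)\in\mathbb R^{d+1},\qquad \lambda_*=\inf\{\lambda\in\mathbb R:(\lambda e+\widetilde H^* )\cap G\ne\emptyset\}$$ (with $\inf\emptyset=\infty$). If $\lambda_*<\infty$, let $$\widetilde N=\bigl\{h\in\mathbb R^{d+1}:h^{d+1}=1\text{ and }\exists a\in\mathbb R:\ \langle h,x\rangle\le a\le\langle h,y\rangle\ \ \forall x\in\lambda_*e+\widetilde H^*,\ \forall y\in G\bigr\},\quad N=\{h\in\mathbb R^d:(h,1)\in\widetilde N\},$$ and if $\lambda_*=\infty$, let $N=\emptyset$. Then $$\sup_{h\in H}u(W+\langle h,X\rangle)=\lambda_*\qquad\text{and}\qquad\mathop{\rm argmax}_{h\in H}u(W+\langle h,X\rangle)=N.$$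
   Context: $(\Omega,\mathcal F,\mathsf P)$ is a probability space, $L^0$ is the space of real random variables, and $\mathcal P$ is the set of probability measures absolutely continuous with respect to $\mathsf P$. $\mathsf E_{\mathsf Q}X=\mathsf E_{\mathsf Q}X^+-\mathsf E_{\mathsf Q}X^-$ with $\infty-\infty=-\infty$. A coherent utility function is a map $u:L^0\to[-\infty,\infty]$ of the form $u(X)=\inf_{\mathsf Q\in\mathcal D}\mathsf E_{\mathsf Q}X$ with nonempty $\mathcal D\subset\mathcal P$; its determining set is the largest such $\mathcal D$ (it is convex). $L^1_w(\mathcal D)=\{X\in L^0:u(X)>-\infty,\ u(-X)>-\infty\}$; $L^1_s(\mathcal D)=\{X\in L^0:\lim_{n\to\infty}\sup_{\mathsf Q\in\mathcal D}\mathsf E_{\mathsf Q}|X|I(|X|>n)=0\}$. "$\mathrm{cl}$" denotes closure. *)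

theory Defs
  imports "HOL-Probability.Probability"
begin

definition L0 :: "'w measure \<Rightarrow> ('w \<Rightarrow> real) set" where
  "L0 M = borel_measurable M"

definition ac_prob_measures :: "'w measure \<Rightarrow> 'w measure set" where
  "ac_prob_measures M = {Q. prob_space Q \<and> sets Q = sets M \<and> absolutely_continuous M Q}"

text \<open>
  The case distinction encodes the convention that infinity minus infinity is minus infinity;
  subtraction on \<^typ>\<open>ereal\<close> would give plus infinity here.
\<close>

definition ext_expectation :: "'w measure \<Rightarrow> ('w \<Rightarrow> real) \<Rightarrow> ereal" where
  "ext_expectation Q X =
    (let p = enn2ereal (\<integral>\<^sup>+ w. ennreal (max (X w) 0) \<partial>Q);
         n = enn2ereal (\<integral>\<^sup>+ w. ennreal (max (- X w) 0) \<partial>Q)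
     in if p = \<infinity> \<and> n = \<infinity> then - \<infinity> else p - n)"

definition lower_expectation :: "'w measure set \<Rightarrow> ('w \<Rightarrow> real) \<Rightarrow> ereal" where
  "lower_expectation D X = (INF Q\<in>D. ext_expectation Q X)"

definition represents :: "'w measure \<Rightarrow> 'w measure set \<Rightarrow> (('w \<Rightarrow> real) \<Rightarrow> ereal) \<Rightarrow> bool" where
  "represents M D u \<longleftrightarrow>
    D \<noteq> {} \<and> D \<subseteq> ac_prob_measures M \<and> (\<forall>X\<in>L0 M. u X = lower_expectation D X)"

definition coherent_utility :: "'w measure \<Rightarrow> (('w \<Rightarrow> real) \<Rightarrow> ereal) \<Rightarrow> bool" where
  "coherent_utility M u \<longleftrightarrow> (\<exists>D. represents M D u)"

definition determining_set ::
  "'w measure \<Rightarrow> (('w \<Rightarrow> real) \<Rightarrow> ereal) \<Rightarrow> 'w measure set \<Rightarrow> bool" where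
  "determining_set M u D \<longleftrightarrow> represents M D u \<and> (\<forall>D'. represents M D' u \<longrightarrow> D' \<subseteq> D)"

lemma determining_set_exists_unique:
  assumes "coherent_utility M u"
  shows "\<exists>!D. determining_set M u D"
proof -
  let ?D = "\<Union>{D. represents M D u}"
  obtain D0 where D0: "represents M D0 u"
    using assms by (auto simp: coherent_utility_def)
  have "u X = lower_expectation ?D X" if X: "X \<in> L0 M" for X
    unfolding lower_expectation_def
  proof (rule antisym)
    show "u X \<le> (INF Q\<in>?D. ext_expectation Q X)"
    proof (rule INF_greatest)
      fix Q assume "Q \<in> ?D"
      then obtain D where "represents M D u" "Q \<in> D" by blast
      then show "u X \<le> ext_expectation Q X"
        using X by (auto simp: represents_def lower_expectation_def intro: INF_lower)
    qed
    show "(INF Q\<in>?D. ext_expectation Q X) \<le> u X"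
    proof -
      have "u X = (INF Q\<in>D0. ext_expectation Q X)"
        using D0 X by (auto simp: represents_def lower_expectation_def)
      then show ?thesis using D0 by (auto intro!: INF_superset_mono)
    qed
  qed
  then have "\<forall>X\<in>L0 M. u X = lower_expectation ?D X" by blast
  moreover have "?D \<noteq> {}" "?D \<subseteq> ac_prob_measures M"
    using D0 unfolding represents_def by blast+
  ultimately have "represents M ?D u"
    unfolding represents_def[of M ?D] by blast
  then show ?thesis
    unfolding determining_set_def by (intro ex1I[of _ ?D]) blast+
qed

definition L1w :: "'w measure \<Rightarrow> 'w measure set \<Rightarrow> ('w \<Rightarrow> real) set" where
  "L1w M D =
    {X \<in> L0 M. lower_expectation D X > - \<infinity> \<and> lower_expectation D (\<lambda>w. - X w) > - \<infinity>}"

definition L1s :: "'w measure \<Rightarrow> 'w measure set \<Rightarrow> ('w \<Rightarrow> real) set" where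
  "L1s M D =
    {X \<in> L0 M.
      (\<lambda>n::nat. SUP Q\<in>D. ext_expectation Q (\<lambda>w. \<bar>X w\<bar> * indicator {w. \<bar>X w\<bar> > real n} w))
        \<longlonglongrightarrow> 0}"

text \<open>
  The space of dimension \<open>d + 1\<close> is rendered as \<^typ>\<open>(real^'d) \<times> real\<close>, with the product inner
  product and topology; the second component is the last coordinate.

  For components in \<^const>\<open>L1w\<close> or \<^const>\<open>L1s\<close> and \<open>Q \<in> D\<close> the extended expectations below are
  finite, so that \<^const>\<open>real_of_ereal\<close> only changes the type.
\<close>

definition expectation_vec ::
  "'w measure \<Rightarrow> ('w \<Rightarrow> real^'d) \<Rightarrow> ('w \<Rightarrow> real) \<Rightarrow> (real^'d) \<times> real" where
  "expectation_vec Q X W =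
    (\<chi> i. real_of_ereal (ext_expectation Q (\<lambda>w. X w $ i)), real_of_ereal (ext_expectation Q W))"

definition G_set ::
  "'w measure set \<Rightarrow> ('w \<Rightarrow> real^'d) \<Rightarrow> ('w \<Rightarrow> real) \<Rightarrow> ((real^'d) \<times> real) set" where
  "G_set D X W = closure {expectation_vec Q X W | Q. Q \<in> D}"

definition H_tilde :: "(real^'d) set \<Rightarrow> ((real^'d) \<times> real) set" where
  "H_tilde H = {x. fst x \<in> H \<and> snd x = 1}"

definition H_tilde_polar :: "(real^'d) set \<Rightarrow> ((real^'d) \<times> real) set" where
  "H_tilde_polar H = {x. \<forall>h\<in>H_tilde H. h \<bullet> x \<le> 0}"

definition e_last :: "(real^'d) \<times> real" where
  "e_last = (0, 1)"

definition shifted_polar :: "(real^'d) set \<Rightarrow> real \<Rightarrow> ((real^'d) \<times> real) set" where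
  "shifted_polar H l = (\<lambda>x. l *\<^sub>R e_last + x) ` H_tilde_polar H"

definition lambda_star ::
  "'w measure set \<Rightarrow> ('w \<Rightarrow> real^'d) \<Rightarrow> ('w \<Rightarrow> real) \<Rightarrow> (real^'d) set \<Rightarrow> ereal" where
  "lambda_star D X W H = Inf (ereal ` {l::real. shifted_polar H l \<inter> G_set D X W \<noteq> {}})"

definition N_tilde ::
  "'w measure set \<Rightarrow> ('w \<Rightarrow> real^'d) \<Rightarrow> ('w \<Rightarrow> real) \<Rightarrow> (real^'d) set \<Rightarrow> ((real^'d) \<times> real) set"
where
  "N_tilde D X W H =
    {h. snd h = 1 \<and>
      (\<exists>a::real. (\<forall>x\<in>shifted_polar H (real_of_ereal (lambda_star D X W H)). h \<bullet> x \<le> a) \<and>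
                 (\<forall>y\<in>G_set D X W. a \<le> h \<bullet> y))}"

text \<open>
  In the first case \<^const>\<open>lambda_star\<close> is a real number: it exceeds minus infinity because \<open>0 \<in> H\<close>
  makes the last coordinate nonpositive on \<^term>\<open>H_tilde_polar H\<close>, while that coordinate is bounded
  below on \<^term>\<open>G_set D X W\<close>.
\<close>

definition N_set ::
  "'w measure set \<Rightarrow> ('w \<Rightarrow> real^'d) \<Rightarrow> ('w \<Rightarrow> real) \<Rightarrow> (real^'d) set \<Rightarrow> (real^'d) set" where
  "N_set D X W H =
    (if lambda_star D X W H < \<infinity> then {h. (h, 1) \<in> N_tilde D X W H} else {})"

end

theory Submission
  imports Defs
begin

text \<open>
  The set \<open>G\<close> is compact, because the expectations are bounded over \<open>D\<close>, and convex, because a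
  determining set contains all mixtures of its members. The utility of \<open>W + \<langle>h, X\<rangle>\<close> is the minimum
  of \<open>\<langle>(h, 1), _\<rangle>\<close> over \<open>G\<close>, whereas for \<open>h \<in> H\<close> the supremum of this functional over the shifted
  polar at level \<open>\<lambda>\<close> is \<open>\<lambda>\<close>. So a common point of the two sets at level \<open>\<lambda>\<close> bounds every utility
  by \<open>\<lambda>\<close>; if they are disjoint, a separating hyperplane can be normalised to one with last
  coefficient \<open>1\<close>, and by the bipolar theorem it comes from some \<open>h \<in> H\<close> with utility at
  least \<open>\<lambda>\<close>. The maximisers are the directions separating at the critical level.
\<close>

section \<open>Polar cones and separation\<close>

text \<open>A linear function that is bounded above on a ray cannot grow along it. This turns bounds
  on cones into sign conditions.\<close>

lemma nonpos_if_multiples_bounded: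
  fixes c d :: real
  assumes "\<And>k. k \<ge> 0 \<Longrightarrow> k * c \<le> d"
  shows "c \<le> 0"
proof (rule ccontr)
  assume "\<not> c \<le> 0"
  then have "((\<bar>d\<bar> + 1) / c) * c \<le> d"
    by (intro assms) auto
  with \<open>\<not> c \<le> 0\<close> show False by simp
qed

text \<open>If \<open>h\<close> lay outside \<open>H\<close>, a hyperplane would separate it
  strictly from \<open>H\<close>. Scaling inside the cone shows that the negated normal
  \<open>- a\<close> is polar to \<open>H\<close>, yet its product with \<open>h\<close> is
  positive.\<close>

lemma bipolar_cone:
  fixes H :: "'a::euclidean_space set"
  assumes "closed H" "convex_cone H"
    and h: "\<And>x. (\<forall>k\<in>H. k \<bullet> x \<le> 0) \<Longrightarrow> h \<bullet> x \<le> 0"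
  shows "h \<in> H"
proof (rule ccontr)
  assume "h \<notin> H"
  then obtain a b where ab: "a \<bullet> h < b" "\<And>x. x \<in> H \<Longrightarrow> b < a \<bullet> x"
    using assms separating_hyperplane_closed_point[of H h] by (auto simp: convex_cone_def)
  have "0 \<in> H"
    using assms(2) by (simp add: convex_cone_iff)
  then have "b < 0"
    using ab(2)[of 0] by simp
  have "k \<bullet> (- a) \<le> 0" if "k \<in> H" for k
  proof (rule nonpos_if_multiples_bounded)
    fix t :: real assume "t \<ge> 0"
    then have "t *\<^sub>R k \<in> H"
      using assms(2) that by (rule_tac convex_cone_scaleR)
    then show "t * (k \<bullet> (- a)) \<le> - b"
      using ab(2)[of "t *\<^sub>R k"] by (simp add: inner_commute)
  qed
  then have "h \<bullet> (- a) \<le> 0"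
    by (intro h) blast
  then show False
    using ab(1) \<open>b < 0\<close> by (simp add: inner_commute)
qed

text \<open>Pairing \<open>z\<close> with \<open>(h, 1)\<close> couples the two components. The
  choice \<open>h = 0\<close> isolates the last coordinate, and arbitrarily large multiples of
  \<open>h\<close> isolate the first component.\<close>

lemma mem_H_tilde_polar_iff:
  assumes "convex_cone H"
  shows "z \<in> H_tilde_polar H \<longleftrightarrow> (\<forall>h\<in>H. h \<bullet> fst z \<le> 0) \<and> snd z \<le> 0"
proof -
  have *: "z \<in> H_tilde_polar H \<longleftrightarrow> (\<forall>h\<in>H. h \<bullet> fst z + snd z \<le> 0)"
    by (cases z) (auto simp: H_tilde_polar_def H_tilde_def)
  show ?thesis
  proof (intro iffI conjI ballI)
    assume z: "z \<in> H_tilde_polar H"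
    have "0 \<in> H"
      using assms by (simp add: convex_cone_iff)
    with z show "snd z \<le> 0"
      unfolding * by force
    show "h \<bullet> fst z \<le> 0" if "h \<in> H" for h
    proof (rule nonpos_if_multiples_bounded)
      fix k :: real assume "k \<ge> 0"
      then have "k *\<^sub>R h \<in> H"
        using assms that by (rule_tac convex_cone_scaleR)
      with z show "k * (h \<bullet> fst z) \<le> - snd z"
        unfolding * by force
    qed
  next
    assume "(\<forall>h\<in>H. h \<bullet> fst z \<le> 0) \<and> snd z \<le> 0"
    then show "z \<in> H_tilde_polar H"
      unfolding * by force
  qed
qed

lemma mem_shifted_polar_iff:
  assumes "convex_cone H"
  shows "z \<in> shifted_polar H l \<longleftrightarrow> (\<forall>h\<in>H. h \<bullet> fst z \<le> 0) \<and> snd z \<le> l"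
proof -
  have "z \<in> shifted_polar H l \<longleftrightarrow> z - l *\<^sub>R e_last \<in> H_tilde_polar H"
    by (force simp: shifted_polar_def image_iff)
  then show ?thesis
    by (simp add: mem_H_tilde_polar_iff[OF assms] e_last_def)
qed

lemma shifted_polar_halfspaces:
  assumes "convex_cone H"
  shows "shifted_polar H l = (\<Inter>h\<in>H. {z. (h, 0) \<bullet> z \<le> 0}) \<inter> {z. (0, 1) \<bullet> z \<le> l}"
  by (auto simp: mem_shifted_polar_iff[OF assms] inner_prod_def)

lemma convex_shifted_polar: "convex_cone H \<Longrightarrow> convex (shifted_polar H l)"
  by (auto simp: shifted_polar_halfspaces intro!: convex_Int convex_INT convex_halfspace_le)

lemma closed_shifted_polar: "convex_cone H \<Longrightarrow> closed (shifted_polar H l)"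
  by (auto simp: shifted_polar_halfspaces intro!: closed_Int closed_INT closed_halfspace_le)

text \<open>The shifted polar is unbounded along the polar of \<open>H\<close> and downwards in the
  last coordinate. A bound along the former puts \<open>h\<close> into the bipolar of
  \<open>H\<close>, a bound along the latter fixes the sign of \<open>s\<close>, and the point
  \<open>(0, l)\<close> gives the last claim.\<close>

lemma bounded_above_on_shifted_polar:
  fixes H :: "(real^'d) set"
  assumes H: "closed H" "convex_cone H"
    and le: "\<And>z. z \<in> shifted_polar H l \<Longrightarrow> (h, s) \<bullet> z \<le> a"
  shows "h \<in> H" "s \<ge> 0" "s * l \<le> a"
proof -
  have "h \<bullet> x \<le> 0" if x: "\<forall>k\<in>H. k \<bullet> x \<le> 0" for x
  proof (rule nonpos_if_multiples_bounded)
    fix t :: real assume "t \<ge> 0"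
    then have "(t *\<^sub>R x, l) \<in> shifted_polar H l"
      using x by (auto simp: mem_shifted_polar_iff[OF H(2)] mult_nonneg_nonpos)
    from le[OF this] show "t * (h \<bullet> x) \<le> a - s * l"
      by simp
  qed
  then show "h \<in> H"
    by (rule bipolar_cone[OF H])
  have "- s \<le> 0"
  proof (rule nonpos_if_multiples_bounded)
    fix t :: real assume "t \<ge> 0"
    then have "(0, l - t) \<in> shifted_polar H l"
      by (auto simp: mem_shifted_polar_iff[OF H(2)])
    from le[OF this] show "t * (- s) \<le> a - s * l"
      by (simp add: algebra_simps)
  qed
  then show "s \<ge> 0" by simp
  have "(0, l) \<in> shifted_polar H l"
    by (auto simp: mem_shifted_polar_iff[OF H(2)])
  from le[OF this] show "s * l \<le> a" by simp
qed

text \<open>Strict separation gives a normal \<open>(h, s)\<close> that is bounded above on the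
  shifted polar, so \<open>h\<close> is in \<open>H\<close> and \<open>s\<close> is nonnegative. It
  remains to bring the last coefficient to \<open>1\<close>.\<close>

lemma ex_dominating_direction:
  fixes H :: "(real^'d) set"
  assumes H: "closed H" "convex_cone H"
    and G: "convex G" "compact G" "G \<noteq> {}"
    and disj: "shifted_polar H l \<inter> G = {}"
  shows "\<exists>h\<in>H. \<forall>y\<in>G. l \<le> (h, 1) \<bullet> y"
proof -
  obtain c b where cb: "\<And>x. x \<in> shifted_polar H l \<Longrightarrow> c \<bullet> x < b" "\<And>y. y \<in> G \<Longrightarrow> b < c \<bullet> y"
    using separating_hyperplane_closed_compact[OF convex_shifted_polar[OF H(2)]
        closed_shifted_polar[OF H(2)] G disj] by blast
  obtain h s where c: "c = (h, s)" by (cases c)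
  have hs: "h \<in> H" "s \<ge> 0"
    using bounded_above_on_shifted_polar[OF H, of l h s b] cb(1) unfolding c by force+
  \<comment> \<open>The preceding lemma would give only the weak inequality; the strict one makes
    \<open>b\<close> positive when \<open>s = 0\<close>.\<close>
  have "(0, l) \<in> shifted_polar H l"
    by (auto simp: mem_shifted_polar_iff[OF H(2)])
  from cb(1)[OF this] have sl: "s * l < b"
    by (simp add: c)
  show ?thesis
  proof (cases "s = 0")
    case False
    with hs have "s > 0" by simp
    show ?thesis
    proof (intro bexI ballI)
      show "(1 / s) *\<^sub>R h \<in> H"
        using hs H(2) by (intro convex_cone_scaleR) auto
      fix y assume "y \<in> G"
      from cb(2)[OF this] sl have "s * l \<le> h \<bullet> fst y + s * snd y"
        by (simp add: c inner_prod_def)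
      with \<open>s > 0\<close> show "l \<le> ((1 / s) *\<^sub>R h, 1) \<bullet> y"
        by (simp add: inner_prod_def field_simps)
    qed
  next
    case True
    txt \<open>A vertical separating hyperplane: its normal is positive on \<open>G\<close>, so a large multiple
      of it compensates the bounded last coordinate.\<close>
    have b: "b > 0"
      using sl True by simp
    obtain B where B: "\<And>y. y \<in> G \<Longrightarrow> norm y \<le> B"
      using compact_imp_bounded[OF G(2)] by (auto simp: bounded_iff)
    \<comment> \<open>On \<open>G\<close> the product with \<open>h\<close> is at least
      \<open>b\<close>, so this multiple contributes enough to reach \<open>l\<close> even where the
      last coordinate is \<open>- B\<close>.\<close>
    define k where "k = (\<bar>l\<bar> + \<bar>B\<bar>) / b"
    have k: "k \<ge> 0" "k * b = \<bar>l\<bar> + \<bar>B\<bar>"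
      using b by (auto simp: k_def)
    show ?thesis
    proof (intro bexI ballI)
      show "k *\<^sub>R h \<in> H"
        using hs H(2) k by (intro convex_cone_scaleR) auto
      fix y assume y: "y \<in> G"
      from cb(2)[OF y] have "b \<le> h \<bullet> fst y"
        by (simp add: c inner_prod_def True)
      with k have "\<bar>l\<bar> + \<bar>B\<bar> \<le> k * (h \<bullet> fst y)"
        by (metis mult_left_mono)
      moreover have "\<bar>snd y\<bar> \<le> B"
        using B[OF y] norm_snd_le[of "snd y" "fst y"] by simp
      ultimately show "l \<le> (k *\<^sub>R h, 1) \<bullet> y"
        by (simp add: inner_prod_def)
    qed
  qed
qed

section \<open>Extended expectations\<close>

lemma ext_expectation_integrable:
  assumes "integrable Q X"
  shows "ext_expectation Q X = ereal (\<integral>w. X w \<partial>Q)"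
proof -
  obtain p n where pn: "(\<integral>\<^sup>+ w. ennreal (X w) \<partial>Q) = ennreal p" "(\<integral>\<^sup>+ w. ennreal (- X w) \<partial>Q) = ennreal n"
    "p \<ge> 0" "n \<ge> 0"
    using assms by (cases "\<integral>\<^sup>+ w. ennreal (X w) \<partial>Q"; cases "\<integral>\<^sup>+ w. ennreal (- X w) \<partial>Q")
      (auto simp: real_integrable_def)
  then show ?thesis
    by (simp add: ext_expectation_def ennreal_max_0' real_lebesgue_integral_def[OF assms])
qed

text \<open>An infinite negative part forces the value minus infinity: by subtraction if the
  positive part is finite, and by the convention otherwise.\<close>

lemma nn_integral_uminus_finite:
  assumes "- \<infinity> < ext_expectation Q X"
  shows "(\<integral>\<^sup>+ w. ennreal (- X w) \<partial>Q) \<noteq> \<infinity>"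
proof
  assume n: "(\<integral>\<^sup>+ w. ennreal (- X w) \<partial>Q) = \<infinity>"
  then have "ext_expectation Q X = - \<infinity>"
    by (cases "enn2ereal (\<integral>\<^sup>+ w. ennreal (X w) \<partial>Q)")
      (auto simp: ext_expectation_def ennreal_max_0')
  with assms show False by simp
qed

lemma ext_expectation_eq_diff:
  assumes "(\<integral>\<^sup>+ w. ennreal (- X w) \<partial>Q) \<noteq> \<infinity>"
  shows "ext_expectation Q X = enn2ereal (\<integral>\<^sup>+ w. ennreal (X w) \<partial>Q) - enn2ereal (\<integral>\<^sup>+ w. ennreal (- X w) \<partial>Q)"
  using assms by (auto simp: ext_expectation_def ennreal_max_0' Let_def)

text \<open>The expectation of \<open>X\<close> controls the negative part, that of
  \<open>- X\<close> the positive part.\<close>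

lemma integrable_if_ext_expectations_finite:
  assumes "X \<in> borel_measurable Q"
    and "- \<infinity> < ext_expectation Q X" "- \<infinity> < ext_expectation Q (\<lambda>w. - X w)"
  shows "integrable Q X"
  using assms(1) nn_integral_uminus_finite[OF assms(2)] nn_integral_uminus_finite[OF assms(3)]
  by (simp add: real_integrable_def)


section \<open>Mixtures of two measures and the convexity of determining sets\<close>

definition mixture :: "real \<Rightarrow> 'w measure \<Rightarrow> 'w measure \<Rightarrow> 'w measure" where
  "mixture p Q R = measure_pmf (bernoulli_pmf p) \<bind> (\<lambda>b. if b then Q else R)"

context
  fixes M Q R :: "'w measure" and p :: real
  assumes Q: "Q \<in> ac_prob_measures M" and R: "R \<in> ac_prob_measures M"
    and p: "0 < p" "p < 1"
begin

lemma measurable_mixture_kernel: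
  "(\<lambda>b. if b then Q else R) \<in> measure_pmf (bernoulli_pmf p) \<rightarrow>\<^sub>M subprob_algebra M"
  using Q R
  by (auto simp: ac_prob_measures_def space_subprob_algebra measurable_def prob_space_imp_subprob_space)

text \<open>Integration against a \<open>bind\<close> averages the inner integrals over the
  Bernoulli variable. The other integral formulas for mixtures are read off from this one.\<close>

lemma nn_integral_mixture:
  assumes "f \<in> borel_measurable M"
  shows "(\<integral>\<^sup>+ w. f w \<partial>mixture p Q R) =
    ennreal p * (\<integral>\<^sup>+ w. f w \<partial>Q) + ennreal (1 - p) * (\<integral>\<^sup>+ w. f w \<partial>R)"
  using p unfolding mixture_def
  by (simp add: nn_integral_bind[OF assms measurable_mixture_kernel] mult.commute)

lemma sets_mixture: "sets (mixture p Q R) = sets M"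
  unfolding mixture_def using Q R by (intro sets_bind) (auto simp: ac_prob_measures_def)

lemma mixture_in_ac_prob_measures: "mixture p Q R \<in> ac_prob_measures M"
proof -
  have "prob_space (mixture p Q R)"
    unfolding mixture_def using Q R
    by (intro prob_space.prob_space_bind[OF _ _ measurable_mixture_kernel] measure_pmf.prob_space_axioms)
      (auto simp: ac_prob_measures_def)
  moreover have "emeasure (mixture p Q R) A = 0" if A: "A \<in> null_sets M" for A
  proof -
    have "A \<in> sets M" using A by auto
    then have "emeasure (mixture p Q R) A = (\<integral>\<^sup>+ w. indicator A w \<partial>mixture p Q R)"
      by (simp add: sets_mixture)
    also have "\<dots> = ennreal p * emeasure Q A + ennreal (1 - p) * emeasure R A"
      using \<open>A \<in> sets M\<close> Q R by (subst nn_integral_mixture) (auto simp: ac_prob_measures_def)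
    also have "\<dots> = 0"
      using A Q R by (force simp: ac_prob_measures_def absolutely_continuous_def)
    finally show ?thesis .
  qed
  ultimately show ?thesis
    by (auto simp: ac_prob_measures_def absolutely_continuous_def sets_mixture null_sets_def)
qed

text \<open>Mixing cannot push an expectation below a common lower bound, even with infinite values.
  Unless \<open>c\<close> is minus infinity, both negative parts are finite, so infinity minus
  infinity does not occur: either a positive part is infinite and so is the mixed expectation, or
  all parts are finite and the bounds are averaged.\<close>

lemma ext_expectation_mixture_ge:
  assumes X: "X \<in> borel_measurable M"
    and c: "c \<le> ext_expectation Q X" "c \<le> ext_expectation R X"
  shows "c \<le> ext_expectation (mixture p Q R) X"
proof (cases "c = - \<infinity>")
  case False
  then have "- \<infinity> < c"
    by (cases c) auto
  then have "- \<infinity> < ext_expectation Q X" "- \<infinity> < ext_expectation R X"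
    using c by (auto intro: less_le_trans)
  then have n: "(\<integral>\<^sup>+ w. ennreal (- X w) \<partial>Q) \<noteq> \<infinity>" "(\<integral>\<^sup>+ w. ennreal (- X w) \<partial>R) \<noteq> \<infinity>"
    by (blast dest: nn_integral_uminus_finite)+
  have Xp: "(\<lambda>w. ennreal (X w)) \<in> borel_measurable M" "(\<lambda>w. ennreal (- X w)) \<in> borel_measurable M"
    using X by auto
  have n': "(\<integral>\<^sup>+ w. ennreal (- X w) \<partial>mixture p Q R) \<noteq> \<infinity>"
    using n by (simp add: nn_integral_mixture[OF Xp(2)] ennreal_mult_eq_top_iff)
  obtain n1 n2 where n12: "(\<integral>\<^sup>+ w. ennreal (- X w) \<partial>Q) = ennreal n1" "n1 \<ge> 0"
    "(\<integral>\<^sup>+ w. ennreal (- X w) \<partial>R) = ennreal n2" "n2 \<ge> 0"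
    using n by (metis ennreal_cases infinity_ennreal_def)
  have N: "(\<integral>\<^sup>+ w. ennreal (- X w) \<partial>mixture p Q R) = ennreal (p * n1 + (1 - p) * n2)"
    using p n12 by (simp add: nn_integral_mixture[OF Xp(2)] ennreal_mult ennreal_plus)
  show ?thesis
  proof (cases "(\<integral>\<^sup>+ w. ennreal (X w) \<partial>Q) = \<infinity> \<or> (\<integral>\<^sup>+ w. ennreal (X w) \<partial>R) = \<infinity>")
    case True
    then have "(\<integral>\<^sup>+ w. ennreal (X w) \<partial>mixture p Q R) = \<infinity>"
      using p by (auto simp: nn_integral_mixture[OF Xp(1)] ennreal_mult_top)
    then show ?thesis
      using p n12 by (simp add: ext_expectation_eq_diff[OF n'] N)
  next
    case False
    then obtain q1 q2 where q: "(\<integral>\<^sup>+ w. ennreal (X w) \<partial>Q) = ennreal q1" "q1 \<ge> 0"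
      "(\<integral>\<^sup>+ w. ennreal (X w) \<partial>R) = ennreal q2" "q2 \<ge> 0"
      by (metis ennreal_cases infinity_ennreal_def)
    have P: "(\<integral>\<^sup>+ w. ennreal (X w) \<partial>mixture p Q R) = ennreal (p * q1 + (1 - p) * q2)"
      using p q by (simp add: nn_integral_mixture[OF Xp(1)] ennreal_mult ennreal_plus)
    have c': "c \<le> ereal (q1 - n1)" "c \<le> ereal (q2 - n2)"
      using c n12 q by (simp_all add: ext_expectation_eq_diff[OF n(1)] ext_expectation_eq_diff[OF n(2)])
    then obtain r where r: "c = ereal r"
      using \<open>c \<noteq> - \<infinity>\<close> by (cases c) auto
    have "r = p * r + (1 - p) * r"
      by (simp add: algebra_simps)
    also have "\<dots> \<le> p * (q1 - n1) + (1 - p) * (q2 - n2)"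
      using c' p unfolding r by (intro add_mono mult_left_mono) auto
    also have "\<dots> = (p * q1 + (1 - p) * q2) - (p * n1 + (1 - p) * n2)"
      by (simp add: algebra_simps)
    finally show ?thesis
      using p n12 q by (simp add: ext_expectation_eq_diff[OF n'] N P r del: ennreal_plus)
  qed
qed simp

lemma
  assumes "integrable Q X" "integrable R X" "X \<in> borel_measurable M"
  shows integrable_mixture: "integrable (mixture p Q R) X"
    and integral_mixture: "(\<integral>w. X w \<partial>mixture p Q R) = p * (\<integral>w. X w \<partial>Q) + (1 - p) * (\<integral>w. X w \<partial>R)"
proof -
  have Xm: "(\<lambda>w. ennreal (X w)) \<in> borel_measurable M" "(\<lambda>w. ennreal (- X w)) \<in> borel_measurable M"
    using assms(3) by auto
  show int: "integrable (mixture p Q R) X"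
    using assms measurable_cong_sets[OF sets_mixture refl]
    by (auto simp: real_integrable_def nn_integral_mixture[OF Xm(1)] nn_integral_mixture[OF Xm(2)]
        ennreal_mult_eq_top_iff)
  have fin: "(\<integral>\<^sup>+ w. ennreal (X w) \<partial>Q) < top" "(\<integral>\<^sup>+ w. ennreal (- X w) \<partial>Q) < top"
    "(\<integral>\<^sup>+ w. ennreal (X w) \<partial>R) < top" "(\<integral>\<^sup>+ w. ennreal (- X w) \<partial>R) < top"
    using assms by (auto simp: real_integrable_def less_top)
  show "(\<integral>w. X w \<partial>mixture p Q R) = p * (\<integral>w. X w \<partial>Q) + (1 - p) * (\<integral>w. X w \<partial>R)"
    using p fin
    by (simp add: real_lebesgue_integral_def int assms nn_integral_mixture[OF Xm(1)]
        nn_integral_mixture[OF Xm(2)] enn2real_plus enn2real_mult ennreal_mult_less_top algebra_simps)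
qed

end

text \<open>Adding the mixture to \<open>D\<close> changes no lower expectation on
  \<open>L0 M\<close>, so the enlarged set still represents \<open>u\<close> and is absorbed by
  maximality.\<close>

lemma mixture_in_determining_set:
  assumes D: "determining_set M u D" and Q: "Q \<in> D" "R \<in> D" and p: "0 < p" "p < 1"
  shows "mixture p Q R \<in> D"
proof -
  let ?S = "mixture p Q R"
  have rep: "represents M D u" and sub: "D \<subseteq> ac_prob_measures M"
    using D by (auto simp: determining_set_def represents_def)
  then have ac: "Q \<in> ac_prob_measures M" "R \<in> ac_prob_measures M"
    using Q by auto
  have "lower_expectation (insert ?S D) X = lower_expectation D X" if "X \<in> L0 M" for X
  proof -
    have "lower_expectation D X \<le> ext_expectation ?S X"
      using that Q unfolding lower_expectation_def L0_def
      by (intro ext_expectation_mixture_ge[OF ac p]) (auto intro: INF_lower)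
    then show ?thesis
      by (simp add: lower_expectation_def inf_absorb2)
  qed
  then have "represents M (insert ?S D) u"
    using rep mixture_in_ac_prob_measures[OF ac p] by (auto simp: represents_def)
  then show ?thesis
    using D by (auto simp: determining_set_def)
qed

section \<open>Integrability and uniform bounds over the determining set\<close>

lemma L1w_integrable_bounded:
  assumes D: "D \<subseteq> ac_prob_measures M" "D \<noteq> {}" and X: "X \<in> L1w M D"
  shows "Q \<in> D \<Longrightarrow> integrable Q X" "\<exists>B. \<forall>Q\<in>D. \<bar>\<integral>w. X w \<partial>Q\<bar> \<le> B"
proof -
  let ?l = "lower_expectation D X" and ?l' = "lower_expectation D (\<lambda>w. - X w)"
  have l: "- \<infinity> < ?l" "- \<infinity> < ?l'"
    using X by (auto simp: L1w_def)
  have le: "?l \<le> ext_expectation Q X" "?l' \<le> ext_expectation Q (\<lambda>w. - X w)" if "Q \<in> D" for Q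
    using that by (auto simp: lower_expectation_def intro: INF_lower)
  show int: "integrable Q X" if "Q \<in> D" for Q
  proof (rule integrable_if_ext_expectations_finite)
    have "sets Q = sets M" "X \<in> borel_measurable M"
      using that D X by (auto simp: ac_prob_measures_def L1w_def L0_def)
    then show "X \<in> borel_measurable Q"
      using measurable_cong_sets by blast
  qed (use le[OF that] l in \<open>auto intro: less_le_trans\<close>)
  \<comment> \<open>Lower bounds for \<open>X\<close> and for \<open>- X\<close> enclose the
    integral, with constants independent of \<open>Q\<close>.\<close>
  have le': "?l \<le> ereal (\<integral>w. X w \<partial>Q)" "?l' \<le> ereal (- (\<integral>w. X w \<partial>Q))" if "Q \<in> D" for Q
    using le[OF that] int[OF that] by (simp_all add: ext_expectation_integrable)
  \<comment> \<open>A member of \<open>D\<close> excludes the value plus infinity for both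
    infima.\<close>
  obtain Q0 where "Q0 \<in> D" using D by auto
  then obtain a b where "?l = ereal a" "?l' = ereal b"
    using l le'[of Q0] by (cases ?l; cases ?l') auto
  then have "\<bar>\<integral>w. X w \<partial>Q\<bar> \<le> \<bar>a\<bar> + \<bar>b\<bar>" if "Q \<in> D" for Q
    using le'[OF that] by simp
  then show "\<exists>B. \<forall>Q\<in>D. \<bar>\<integral>w. X w \<partial>Q\<bar> \<le> B"
    by blast
qed

text \<open>A single truncation level suffices: once the tail expectations are uniformly below
  \<open>1\<close>, splitting \<open>W\<close> at \<open>n\<close> bounds the integral of its
  absolute value by \<open>n + 1\<close> for every \<open>Q\<close> in \<open>D\<close>.\<close>

lemma L1s_subset_L1w:
  assumes D: "D \<subseteq> ac_prob_measures M" and W: "W \<in> L1s M D"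
  shows "W \<in> L1w M D"
proof -
  let ?t = "\<lambda>n w. \<bar>W w\<bar> * indicator {w. \<bar>W w\<bar> > real n} w :: real"
  have W0: "W \<in> borel_measurable M"
    and lim: "(\<lambda>n. SUP Q\<in>D. ext_expectation Q (?t n)) \<longlonglongrightarrow> 0"
    using W by (auto simp: L1s_def L0_def)
  have "\<forall>\<^sub>F n in sequentially. (SUP Q\<in>D. ext_expectation Q (?t n)) < 1"
    using lim by (rule order_tendstoD) simp
  then obtain n where n: "(SUP Q\<in>D. ext_expectation Q (?t n)) < 1"
    by (auto simp: eventually_sequentially)
  have bound: "integrable Q W \<and> \<bar>\<integral>w. W w \<partial>Q\<bar> \<le> real n + 1" if Q: "Q \<in> D" for Q
  proof -
    interpret prob_space Q
      using Q D by (auto simp: ac_prob_measures_def)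
    have [measurable]: "W \<in> borel_measurable Q"
    proof -
      have "sets Q = sets M"
        using Q D by (auto simp: ac_prob_measures_def)
      then show ?thesis
        using W0 measurable_cong_sets by blast
    qed
    \<comment> \<open>The tail is nonnegative, so its extended expectation is the plain nonnegative
      integral.\<close>
    have neg: "(\<lambda>w. ennreal (- ?t n w)) = (\<lambda>w. 0)"
      by (auto simp: fun_eq_iff ennreal_eq_0_iff indicator_def)
    have "ext_expectation Q (?t n) < 1"
      using n Q by (meson SUP_upper le_less_trans)
    then have "enn2ereal (\<integral>\<^sup>+ w. ennreal (?t n w) \<partial>Q) < 1"
      by (subst (asm) ext_expectation_eq_diff) (simp_all add: neg zero_ennreal.rep_eq)
    then have t: "(\<integral>\<^sup>+ w. ennreal (?t n w) \<partial>Q) \<le> 1"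
      by (metis less_ennreal.rep_eq less_imp_le one_ennreal.rep_eq)
    have "(\<integral>\<^sup>+ w. ennreal \<bar>W w\<bar> \<partial>Q) \<le> (\<integral>\<^sup>+ w. ennreal (real n) + ennreal (?t n w) \<partial>Q)"
      by (intro nn_integral_mono) (auto simp: indicator_def ennreal_leI simp flip: ennreal_plus)
    also have "\<dots> = ennreal (real n) + (\<integral>\<^sup>+ w. ennreal (?t n w) \<partial>Q)"
      by (subst nn_integral_add) (auto simp: emeasure_space_1)
    also have "\<dots> \<le> ennreal (real n) + 1"
      using t by (intro add_left_mono)
    also have "\<dots> = ennreal (real n + 1)"
      by (simp add: ennreal_plus)
    finally have le: "(\<integral>\<^sup>+ w. ennreal \<bar>W w\<bar> \<partial>Q) \<le> ennreal (real n + 1)" .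
    then have int: "integrable Q W"
      by (intro integrableI_bounded) (auto intro: le_less_trans)
    have "ennreal \<bar>\<integral>w. W w \<partial>Q\<bar> \<le> ennreal (real n + 1)"
      using integral_norm_bound_ennreal[OF int] le by auto
    with int show ?thesis
      by (simp add: ennreal_le_iff del: ennreal_plus)
  qed
  have "ereal (- (real n + 1)) \<le> lower_expectation D W"
    "ereal (- (real n + 1)) \<le> lower_expectation D (\<lambda>w. - W w)"
    unfolding lower_expectation_def using bound
    by (force intro!: INF_greatest simp: ext_expectation_integrable)+
  then show ?thesis
    using W0 unfolding L1w_def L0_def by (auto intro: less_le_trans[rotated])
qed


section \<open>The set of expectation vectors\<close>

lemma G_set_convex:
  assumes D: "determining_set M u D"
    and X: "\<And>i. (\<lambda>w. X w $ i) \<in> L1w M D" and W: "W \<in> L1w M D"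
  shows "convex (G_set D X W)"
proof -
  have sub: "D \<subseteq> ac_prob_measures M" "D \<noteq> {}"
    using D by (auto simp: determining_set_def represents_def)
  have int: "integrable Q Y" "Y \<in> borel_measurable M" if "Q \<in> D" "Y \<in> L1w M D" for Q Y
    using L1w_integrable_bounded(1)[OF sub that(2,1)] that(2) by (auto simp: L1w_def L0_def)
  have mix: "real_of_ereal (ext_expectation (mixture p Q R) Y) =
      p * real_of_ereal (ext_expectation Q Y) + (1 - p) * real_of_ereal (ext_expectation R Y)"
    if "Q \<in> D" "R \<in> D" "Y \<in> L1w M D" "0 < p" "p < 1" for Q R p Y
  proof -
    have ac: "Q \<in> ac_prob_measures M" "R \<in> ac_prob_measures M"
      using that sub by auto
    note Y = int(1)[OF that(1,3)] int(1)[OF that(2,3)] int(2)[OF that(1,3)]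
    show ?thesis
      by (simp add: ext_expectation_integrable Y integral_mixture[OF ac that(4,5) Y]
          integrable_mixture[OF ac that(4,5) Y])
  qed
  have "convex {expectation_vec Q X W | Q. Q \<in> D}"
    unfolding convex_alt
  proof (intro ballI allI impI)
    fix x y and p :: real
    assume "x \<in> {expectation_vec Q X W | Q. Q \<in> D}" "y \<in> {expectation_vec Q X W | Q. Q \<in> D}"
    then obtain R Q where QR: "x = expectation_vec R X W" "y = expectation_vec Q X W" "Q \<in> D" "R \<in> D"
      by blast
    assume p: "0 \<le> p \<and> p \<le> 1"
    \<comment> \<open>The facts on mixtures require weights strictly between \<open>0\<close> and
      \<open>1\<close>; the endpoints return \<open>x\<close> or \<open>y\<close>.\<close>
    consider "p = 0" | "p = 1" | "0 < p" "p < 1" using p by linarith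
    then show "(1 - p) *\<^sub>R x + p *\<^sub>R y \<in> {expectation_vec Q X W | Q. Q \<in> D}"
    proof cases
      case 3
      have "(1 - p) *\<^sub>R x + p *\<^sub>R y = expectation_vec (mixture p Q R) X W"
        using mix[OF QR(3,4) X 3] mix[OF QR(3,4) W 3]
        by (simp add: QR expectation_vec_def vec_eq_iff)
      then show ?thesis
        using mixture_in_determining_set[OF D QR(3,4) 3] by blast
    qed (use QR in auto)
  qed
  then show ?thesis
    unfolding G_set_def by (rule convex_closure)
qed

lemma G_set_compact:
  fixes X :: "'w \<Rightarrow> real^'d"
  assumes D: "D \<subseteq> ac_prob_measures M" "D \<noteq> {}"
    and X: "\<And>i. (\<lambda>w. X w $ i) \<in> L1w M D" and W: "W \<in> L1w M D"
  shows "compact (G_set D X W)"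
proof -
  note int = L1w_integrable_bounded(1)[OF D]
  obtain B where B: "\<And>i Q. Q \<in> D \<Longrightarrow> \<bar>\<integral>w. X w $ i \<partial>Q\<bar> \<le> B i"
    using L1w_integrable_bounded(2)[OF D X] by metis
  obtain C where C: "\<And>Q. Q \<in> D \<Longrightarrow> \<bar>\<integral>w. W w \<partial>Q\<bar> \<le> C"
    using L1w_integrable_bounded(2)[OF D W] by metis
  have "norm (expectation_vec Q X W) \<le> (\<Sum>i\<in>UNIV. B i) + C" if Q: "Q \<in> D" for Q
  proof -
    have "norm (expectation_vec Q X W) \<le> norm (fst (expectation_vec Q X W)) + norm (snd (expectation_vec Q X W))"
      using norm_Pair_le[of "fst (expectation_vec Q X W)" "snd (expectation_vec Q X W)"] by simp
    also have "\<dots> \<le> (\<Sum>i\<in>UNIV. B i) + C"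
    proof (rule add_mono)
      show "norm (fst (expectation_vec Q X W)) \<le> (\<Sum>i\<in>UNIV. B i)"
        using B[OF Q] int[OF X Q]
        by (intro order_trans[OF norm_le_l1_cart] sum_mono)
          (simp add: expectation_vec_def ext_expectation_integrable)
      show "norm (snd (expectation_vec Q X W)) \<le> C"
        using C[OF Q] int[OF W Q] by (simp add: expectation_vec_def ext_expectation_integrable)
    qed
    finally show ?thesis .
  qed
  then have "bounded {expectation_vec Q X W | Q. Q \<in> D}"
    unfolding bounded_iff by blast
  then show ?thesis
    by (simp add: G_set_def compact_closure)
qed

text \<open>Under each \<open>Q\<close> the expectation is the functional \<open>(h, 1)\<close> at
  the expectation vector. A lower bound on it describes a closed half-space, so passing to the
  closure adds no condition.\<close>

lemma le_lower_expectation_iff: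
  fixes X :: "'w \<Rightarrow> real^'d"
  assumes D: "D \<subseteq> ac_prob_measures M" "D \<noteq> {}"
    and X: "\<And>i. (\<lambda>w. X w $ i) \<in> L1w M D" and W: "W \<in> L1w M D"
  shows "ereal v \<le> lower_expectation D (\<lambda>w. W w + h \<bullet> X w) \<longleftrightarrow> (\<forall>y\<in>G_set D X W. v \<le> (h, 1) \<bullet> y)"
proof -
  have ext: "ext_expectation Q (\<lambda>w. W w + h \<bullet> X w) = ereal ((h, 1) \<bullet> expectation_vec Q X W)"
    if Q: "Q \<in> D" for Q
  proof -
    note int = L1w_integrable_bounded(1)[OF D W Q] L1w_integrable_bounded(1)[OF D X Q]
    have "integrable Q (\<lambda>w. W w + h \<bullet> X w)"
      using int by (simp add: inner_vec_def)
    then show ?thesis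
      using int by (simp add: ext_expectation_integrable expectation_vec_def inner_vec_def)
  qed
  have "ereal v \<le> lower_expectation D (\<lambda>w. W w + h \<bullet> X w) \<longleftrightarrow>
      {expectation_vec Q X W | Q. Q \<in> D} \<subseteq> {y. (h, 1) \<bullet> y \<ge> v}"
    by (auto simp: lower_expectation_def le_INF_iff ext)
  also have "\<dots> \<longleftrightarrow> G_set D X W \<subseteq> {y. (h, 1) \<bullet> y \<ge> v}"
    unfolding G_set_def
    using closure_minimal[OF _ closed_halfspace_ge[of v "(h, 1)"]] subset_trans[OF closure_subset] by blast
  finally show ?thesis by blast
qed

section \<open>Duality between utilities and the critical level\<close>

theorem theorem2p7:
  fixes M :: "'w measure"
    and u :: "('w \<Rightarrow> real) \<Rightarrow> ereal"
    and D :: "'w measure set"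
    and X :: "'w \<Rightarrow> real^'d"
    and W :: "'w \<Rightarrow> real"
    and H :: "(real^'d) set"
  assumes "prob_space M"
    and "coherent_utility M u"
    and "determining_set M u D"
    and "\<And>i. (\<lambda>w. X w $ i) \<in> L1w M D"
    and "W \<in> L1s M D"
    and "closed H"
    and "convex_cone H"
  shows "(SUP h\<in>H. u (\<lambda>w. W w + h \<bullet> X w)) = lambda_star D X W H \<and>
    {h. is_arg_max (\<lambda>h. u (\<lambda>w. W w + h \<bullet> X w)) (\<lambda>h. h \<in> H) h} = N_set D X W H"
proof -
  note X = assms(4) and H = assms(6,7)
  have D: "D \<subseteq> ac_prob_measures M" "D \<noteq> {}" and rep: "represents M D u"
    using assms(3) by (auto simp: determining_set_def represents_def)
  note W = L1s_subset_L1w[OF D(1) assms(5)]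
  let ?G = "G_set D X W" and ?l = "lambda_star D X W H"
  define f where "f h = u (\<lambda>w. W w + h \<bullet> X w)" for h
  note comp = G_set_compact[OF D X W] and conv = G_set_convex[OF assms(3) X W]
  have ne: "?G \<noteq> {}"
    using D(2) unfolding G_set_def by blast
  have f_ge: "ereal v \<le> f h \<longleftrightarrow> (\<forall>y\<in>?G. v \<le> (h, 1) \<bullet> y)" for v h
  proof -
    have [measurable]: "\<And>i. (\<lambda>w. X w $ i) \<in> borel_measurable M" "W \<in> borel_measurable M"
      using X W by (simp_all add: L1w_def L0_def)
    have "(\<lambda>w. W w + h \<bullet> X w) \<in> L0 M"
      unfolding L0_def inner_vec_def by simp
    with rep have "f h = lower_expectation D (\<lambda>w. W w + h \<bullet> X w)"
      unfolding f_def represents_def by blast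
    then show ?thesis
      using le_lower_expectation_iff[OF D X W] by simp
  qed
  have f_fin: "\<bar>f h\<bar> \<noteq> \<infinity>" for h
  proof -
    obtain y where "y \<in> ?G" using ne by blast
    \<comment> \<open>Otherwise \<open>f_ge\<close>, applied at \<open>y\<close> itself, would bound
      a number below by its successor.\<close>
    then have ub: "\<not> ereal ((h, 1) \<bullet> y + 1) \<le> f h"
      unfolding f_ge by (metis add_le_same_cancel1 not_one_le_zero)
    have "bounded ((\<bullet>) (h, 1) ` ?G)"
      using comp by (intro bounded_linear_image compact_imp_bounded bounded_linear_inner_right)
    then obtain B where "\<forall>y\<in>?G. \<bar>(h, 1) \<bullet> y\<bar> \<le> B"
      by (auto simp: bounded_iff)
    then have "ereal (- B) \<le> f h"
      unfolding f_ge by (metis abs_le_D2 minus_le_iff)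
    with ub show ?thesis
      by (cases "f h") auto
  qed
  \<comment> \<open>A common point \<open>z\<close> bounds \<open>f h\<close> by
    \<open>(h, 1) \<bullet> z\<close>, since \<open>z\<close> is in \<open>G\<close>; this is at
    most \<open>l\<close>, since \<open>z\<close> is in the shifted polar.\<close>
  have f_le: "f h \<le> ereal l" if hl: "h \<in> H" "shifted_polar H l \<inter> ?G \<noteq> {}" for h l
  proof -
    obtain z where z: "z \<in> ?G" "h \<bullet> fst z \<le> 0" "snd z \<le> l"
      using hl mem_shifted_polar_iff[OF H(2)] by blast
    obtain r where r: "f h = ereal r"
      using f_fin by (metis ereal_real')
    then have "r \<le> (h, 1) \<bullet> z"
      using f_ge[of r h] z(1) by simp
    with z r show ?thesis
      by (simp add: inner_prod_def)
  qed
  have sup: "(SUP h\<in>H. f h) = ?l"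
  proof (rule antisym)
    show "(SUP h\<in>H. f h) \<le> ?l"
      unfolding lambda_star_def by (auto intro!: SUP_least Inf_greatest f_le)
    show "?l \<le> (SUP h\<in>H. f h)"
    proof (rule ccontr)
      assume "\<not> ?l \<le> (SUP h\<in>H. f h)"
      \<comment> \<open>A real level strictly inside the supposed gap: being below
        \<open>lambda_star\<close>, it makes the two sets disjoint, and the resulting direction
        beats the supremum.\<close>
      then obtain l where l: "(SUP h\<in>H. f h) < ereal l" "ereal l < ?l"
        using ereal_dense2 by (metis not_le)
      have "shifted_polar H l \<inter> ?G = {}"
      proof (rule ccontr)
        assume "shifted_polar H l \<inter> ?G \<noteq> {}"
        then have "?l \<le> ereal l"
          unfolding lambda_star_def by (intro Inf_lower) auto
        with l(2) show False by simp
      qed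
      then obtain h where "h \<in> H" "\<forall>y\<in>?G. l \<le> (h, 1) \<bullet> y"
        using ex_dominating_direction[OF H conv comp ne] by blast
      then have "ereal l \<le> (SUP h\<in>H. f h)"
        using f_ge by (intro SUP_upper2) auto
      with l(1) show False by simp
    qed
  qed
  \<comment> \<open>In a linear order, having no strictly better competitor in \<open>H\<close>
    means dominating the supremum.\<close>
  have arg: "is_arg_max f (\<lambda>h. h \<in> H) h \<longleftrightarrow> h \<in> H \<and> ?l \<le> f h" for h
    unfolding is_arg_max_def sup[symmetric] by (auto simp: SUP_le_iff not_less)
  have "{h. is_arg_max f (\<lambda>h. h \<in> H) h} = N_set D X W H"
  proof (cases "?l < \<infinity>")
    case False
    \<comment> \<open>Finite utilities never attain an infinite supremum, in agreement with the
      empty \<open>N_set\<close>.\<close>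
    then have "\<not> ?l \<le> f h" for h
      using f_fin[of h] by auto
    with False show ?thesis
      by (auto simp: arg N_set_def)
  next
    case True
    \<comment> \<open>The finite value \<open>f 0\<close> keeps \<open>?l\<close> above minus
      infinity, so \<open>real_of_ereal\<close> in \<open>N_tilde\<close> returns the true level and
      not a default.\<close>
    have "0 \<in> H"
      using H(2) by (simp add: convex_cone_iff)
    then have "f 0 \<le> ?l"
      unfolding sup[symmetric] by (rule SUP_upper)
    with True f_fin[of 0] obtain l where l: "?l = ereal l"
      by (cases ?l) auto
    have "h \<in> N_set D X W H \<longleftrightarrow> h \<in> H \<and> ereal l \<le> f h" for h
    proof -
      have "h \<in> N_set D X W H \<longleftrightarrow>
          (\<exists>a. (\<forall>x\<in>shifted_polar H l. (h, 1) \<bullet> x \<le> a) \<and> (\<forall>y\<in>?G. a \<le> (h, 1) \<bullet> y))"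
        by (simp add: N_set_def N_tilde_def l)
      also have "\<dots> \<longleftrightarrow> h \<in> H \<and> (\<forall>y\<in>?G. l \<le> (h, 1) \<bullet> y)"
      proof
        assume "\<exists>a. (\<forall>x\<in>shifted_polar H l. (h, 1) \<bullet> x \<le> a) \<and> (\<forall>y\<in>?G. a \<le> (h, 1) \<bullet> y)"
        then obtain a where a: "\<And>x. x \<in> shifted_polar H l \<Longrightarrow> (h, 1) \<bullet> x \<le> a"
          "\<And>y. y \<in> ?G \<Longrightarrow> a \<le> (h, 1) \<bullet> y" by blast
        \<comment> \<open>Boundedness on the shifted polar yields both \<open>h \<in> H\<close> and
          \<open>l \<le> a\<close>.\<close>
        show "h \<in> H \<and> (\<forall>y\<in>?G. l \<le> (h, 1) \<bullet> y)"
          using bounded_above_on_shifted_polar(1,3)[OF H a(1)] a(2) by force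
      next
        assume "h \<in> H \<and> (\<forall>y\<in>?G. l \<le> (h, 1) \<bullet> y)"
        \<comment> \<open>The level \<open>l\<close> itself separates, because for \<open>h\<close>
          in \<open>H\<close> it bounds the functional on the shifted polar.\<close>
        then show "\<exists>a. (\<forall>x\<in>shifted_polar H l. (h, 1) \<bullet> x \<le> a) \<and> (\<forall>y\<in>?G. a \<le> (h, 1) \<bullet> y)"
          by (intro exI[of _ l]) (force simp: mem_shifted_polar_iff[OF H(2)] inner_prod_def)
      qed
      finally show ?thesis
        by (simp add: f_ge)
    qed
    then show ?thesis
      by (auto simp: arg l)
  qed
  with sup show ?thesis
    unfolding f_def[abs_def] by blast
qed

end
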